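(* Let $1<q<\infty$. If $u\in BV_w(\mathbb{R}^N)\cap VMO(\mathbb{R}^N)$, then $$\lim_{h\to0}\int_{\mathbb{R}^N}\frac{|u(x+h)-u(x)|^q}{|h|}\,dx=0 .$$
   Context: $\mathcal{L}^N$ is Lebesgue measure. $[f]_{L^1_w(\mathbb{R}^N)}:=\sup_{t>0}t\,\mathcal{L}^N(\{|f|>t\})$, and $L^1_w(\mathbb{R}^N)$ is the set of measurable $f$ for which it is finite. $u\in BV_w(\mathbb{R}^N)$ means that $u\in L^1_w(\mathbb{R}^N)$ and $$\sup_{h\in\mathbb{R}^N\setminus\{0\}}\frac{[u(\cdot+h)-u]_{L^1_w(\mathbb{R}^N)}}{|h|}<\infty .$$ A cube is a Cartesian product of $N$ non-empty closed bounded intervals of the same (positive) length. For real-valued $u\in L^1_{\mathrm{loc}}(\mathbb{R}^N)$, $u\in BMO(\mathbb{R}^N)$ means that $\sup_C \frac{1}{\mathcal{L}^N(C)^2}\int_C\int_C|u(z)-u(x)|\,dz\,dx<\infty$, the supremum being over all cubes $C\subset\mathbb{R}^N$. $VMO(\mathbb{R}^N)$ is the set of $u\in BMO(\mathbb{R}^N)$ with $$\lim_{R\to0^+}\ \sup_{C\text{ cube},\ \operatorname{diam}(C)\le R}\ \frac{1}{\mathcal{L}^N(C)^2}\int_C\int_C|u(x)-u(z)|\,dx\,dz=0 .$$ *)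

theory Defs
  imports "HOL-Analysis.Analysis"
begin

text \<open>Suprema and integrals of nonnegative quantities are taken in \<^typ>\<open>ennreal\<close>,
  so no finiteness is built in silently; measurability refers to the completed Lebesgue measure.\<close>

definition weak_L1_quasinorm :: "(real^'n \<Rightarrow> real) \<Rightarrow> ennreal" where
  "weak_L1_quasinorm f = (SUP t\<in>{0<..}. ennreal t * emeasure lebesgue {x. \<bar>f x\<bar> > t})"

definition weak_L1 :: "(real^'n \<Rightarrow> real) set" where
  "weak_L1 = {f. f \<in> borel_measurable lebesgue \<and> weak_L1_quasinorm f < \<infinity>}"

definition BV_w :: "(real^'n \<Rightarrow> real) set" where
  "BV_w = {u. u \<in> weak_L1 \<and>
     (SUP h\<in>UNIV - {0}. weak_L1_quasinorm (\<lambda>x. u (x + h) - u x) / ennreal (norm h)) < \<infinity>}"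

definition is_cube :: "(real^'n) set \<Rightarrow> bool" where
  "is_cube C \<longleftrightarrow> (\<exists>a l. 0 < l \<and> C = {x. \<forall>i. x $ i \<in> {a $ i .. a $ i + l}})"

definition L1_loc :: "(real^'n \<Rightarrow> real) set" where
  "L1_loc = {u. u \<in> borel_measurable lebesgue \<and>
     (\<forall>K. compact K \<longrightarrow> set_integrable lebesgue K u)}"

definition mean_oscillation :: "(real^'n \<Rightarrow> real) \<Rightarrow> (real^'n) set \<Rightarrow> ennreal" where
  "mean_oscillation u C =
     (\<integral>\<^sup>+x\<in>C. (\<integral>\<^sup>+z\<in>C. ennreal \<bar>u z - u x\<bar> \<partial>lebesgue) \<partial>lebesgue) / (emeasure lebesgue C)\<^sup>2"

definition BMO :: "(real^'n \<Rightarrow> real) set" where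
  "BMO = {u. u \<in> L1_loc \<and> (SUP C\<in>{C. is_cube C}. mean_oscillation u C) < \<infinity>}"

definition VMO :: "(real^'n \<Rightarrow> real) set" where
  "VMO = {u. u \<in> BMO \<and>
     ((\<lambda>R. SUP C\<in>{C. is_cube C \<and> diameter C \<le> R}. mean_oscillation u C) \<longlongrightarrow> 0) (at_right (0::real))}"

end

theory Submission
  imports Defs
begin

text \<open>
  Let \<open>w x = u (x + h) - u x\<close> and let \<open>\<mu> t\<close> be the measure of \<open>{\<bar>w\<bar> > t}\<close>. Membership in \<open>BV_w\<close>
  gives \<open>\<mu> t \<le> M \<bar>h\<bar> / t\<close>. Fix \<open>\<delta> > 0\<close>. Since \<open>u\<close> is in \<open>VMO\<close>, the mean oscillation of \<open>w\<close> on all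
  small cubes is at most a small multiple of \<open>\<delta>\<close>. If \<open>\<bar>h\<bar>\<close> is small, then for \<open>t \<ge> \<delta>\<close> the set \<open>{\<bar>w\<bar> > t}\<close>
  has small density in every cube of a fixed side, and a Calderon-Zygmund stopping argument yields a
  good-\<open>\<lambda>\<close> inequality \<open>s * \<mu> (t + s) \<le> \<theta> \<delta> * \<mu> t\<close> in which \<open>\<theta>\<close> is as small as we please. With \<open>s = t\<close> it
  shows that doubling the level divides the measure by \<open>2 ^ p\<close>, so \<open>\<mu> t \<le> (2 \<delta> / t) ^ p * \<mu> \<delta>\<close> for
  \<open>t \<ge> \<delta>\<close>. Interpolating at level \<open>\<delta>\<close> between this bound with \<open>p > q\<close> and the weak \<open>L\<^sup>1\<close> bound gives
  \<open>\<integral>\<bar>w\<bar> ^ q \<le> C M \<bar>h\<bar> \<delta> ^ (q - 1)\<close>, and \<open>\<delta>\<close> is arbitrary.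
\<close>

declare emeasure_completion [simp del]

section \<open>Preliminaries on measures\<close>

lemma emeasure_Int_Union_disjoint:
  assumes "countable \<Q>" "disjoint \<Q>" "\<Q> \<subseteq> sets M" "A \<in> sets M"
  shows "emeasure M (A \<inter> \<Union>\<Q>) = (\<integral>\<^sup>+Q. emeasure M (A \<inter> Q) \<partial>count_space \<Q>)"
proof -
  have "A \<inter> \<Union>\<Q> = (\<Union>Q\<in>\<Q>. A \<inter> Q)"
    by blast
  moreover have "disjoint_family_on ((\<inter>) A) \<Q>"
    using assms(2) by (auto simp: disjoint_family_on_def disjoint_def)
  ultimately show ?thesis
    using assms by (simp only:) (intro emeasure_UN_countable, auto)
qed

lemma emeasure_Int_Union_disjoint_mono:
  fixes c d :: ennreal
  assumes family: "countable \<Q>" "disjoint \<Q>" "\<Q> \<subseteq> sets M" and sets: "A \<in> sets M" "B \<in> sets M"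
    and cellwise: "\<And>Q. Q \<in> \<Q> \<Longrightarrow> c * emeasure M (A \<inter> Q) \<le> d * emeasure M (B \<inter> Q)"
  shows "c * emeasure M (A \<inter> \<Union>\<Q>) \<le> d * emeasure M (B \<inter> \<Union>\<Q>)"
proof -
  have "(\<integral>\<^sup>+Q. c * emeasure M (A \<inter> Q) \<partial>count_space \<Q>)
      \<le> (\<integral>\<^sup>+Q. d * emeasure M (B \<inter> Q) \<partial>count_space \<Q>)"
    using cellwise by (intro nn_integral_mono) simp
  then show ?thesis
    by (simp add: emeasure_Int_Union_disjoint[OF family] sets nn_integral_cmult)
qed

lemma outer_open_scaled_emeasure_less:
  fixes F :: "'a::euclidean_space set"
  assumes F_pos: "F \<in> lmeasurable" "emeasure lebesgue F \<noteq> 0" and \<tau>_bounds: "0 \<le> \<tau>" "\<tau> < 1"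
  obtains G where "open G" "F \<subseteq> G" "ennreal \<tau> * emeasure lebesgue G < emeasure lebesgue F"
proof -
  obtain m where m_eq: "0 < m" "emeasure lebesgue F = ennreal m"
    using F_pos by (metis emeasure_eq_measure2 ennreal_0 measure_nonneg less_le)
  have "0 < (1 - \<tau>) * m"
    using m_eq \<tau>_bounds by simp
  then obtain G where G_outer: "open G" "F \<subseteq> G" "G - F \<in> lmeasurable"
    "emeasure lebesgue (G - F) < ennreal ((1 - \<tau>) * m)"
    using sets_lebesgue_outer_open F_pos(1) by blast
  have "emeasure lebesgue G = emeasure lebesgue (F \<union> (G - F))"
    using G_outer(2) by (simp add: Un_absorb1)
  also have "\<dots> \<le> ennreal m + emeasure lebesgue (G - F)"
    unfolding m_eq(2)[symmetric] using F_pos G_outer by (intro emeasure_subadditive) auto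
  also have "\<dots> \<le> ennreal m + ennreal ((1 - \<tau>) * m)"
    using G_outer(4) by (intro add_left_mono) simp
  also have "\<dots> = ennreal ((2 - \<tau>) * m)"
    using m_eq \<tau>_bounds by (simp flip: ennreal_plus) (simp add: algebra_simps)
  finally have "ennreal \<tau> * emeasure lebesgue G \<le> ennreal \<tau> * ennreal ((2 - \<tau>) * m)"
    by (rule mult_left_mono) simp
  also have "\<dots> = ennreal ((1 - (1 - \<tau>)\<^sup>2) * m)"
    using \<tau>_bounds by (simp add: ennreal_mult'[symmetric] power2_eq_square algebra_simps)
  also have "\<dots> < ennreal m"
  proof (rule ennreal_lessI)
    show "(1 - (1 - \<tau>)\<^sup>2) * m < m"
      using m_eq \<tau>_bounds by (simp add: algebra_simps)
  qed (use m_eq in simp)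
  finally show thesis
    using that G_outer m_eq(2) by metis
qed

lemma sigma_finite_completion:
  assumes "sigma_finite_measure M"
  shows "sigma_finite_measure (completion M)"
proof -
  obtain A where "countable A" "A \<subseteq> sets M" "\<Union>A = space M" "\<forall>a\<in>A. emeasure M a \<noteq> \<infinity>"
    using sigma_finite_measure.sigma_finite_countable[OF assms] by blast
  then show ?thesis
    by (intro sigma_finite_measure.intro exI[of _ A])
      (auto simp: sets_completionI_sets subset_iff emeasure_completion)
qed

interpretation lebesgue: sigma_finite_measure lebesgue
  by (rule sigma_finite_completion) (rule sigma_finite_lborel)

lemma distr_lebesgue_translation:
  "distr lebesgue lebesgue (\<lambda>x. x + h) = (lebesgue :: 'a::euclidean_space measure)"
  and measurable_lebesgue_translation [measurable]:
  "(\<lambda>x. x + h) \<in> lebesgue \<rightarrow>\<^sub>M (lebesgue :: 'a::euclidean_space measure)"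
  using lebesgue_affine_euclidean[of "\<lambda>_. 1" h] lebesgue_affine_measurable[of "\<lambda>_. 1" h]
  by (simp_all add: euclidean_representation add.commute density_1)

lemma nn_integral_lebesgue_translation:
  fixes f :: "'a::euclidean_space \<Rightarrow> ennreal"
  assumes "f \<in> borel_measurable lebesgue"
  shows "(\<integral>\<^sup>+x. f (x + h) \<partial>lebesgue) = (\<integral>\<^sup>+x. f x \<partial>lebesgue)"
  using nn_integral_distr[OF measurable_lebesgue_translation, of f h] assms
  by (simp add: distr_lebesgue_translation)

lemma emeasure_lebesgue_translation:
  "emeasure lebesgue ((+) h ` S) = emeasure lebesgue (S :: 'a::euclidean_space set)"
  using emeasure_lebesgue_affine[of 1 h S] by (simp add: add.commute[of _ h])

section \<open>Cubes and grids\<close>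

definition cube :: "'a::euclidean_space \<Rightarrow> real \<Rightarrow> 'a set" where
  "cube a l = cbox a (a + l *\<^sub>R One)"

lemma sets_cube [measurable, simp]: "cube a l \<in> sets lebesgue"
  by (simp add: cube_def)

lemma emeasure_cube:
  fixes a :: "'a::euclidean_space"
  assumes "0 \<le> l"
  shows "emeasure lebesgue (cube a l) = ennreal (l ^ DIM('a))"
  using assms by (simp add: cube_def emeasure_completion emeasure_lborel_cbox_eq inner_add_left)

lemma norm_One: "norm (One :: 'a::euclidean_space) = sqrt DIM('a)"
  by (simp add: norm_eq_sqrt_inner euclidean_inner[of One One])

lemma diameter_cube:
  fixes a :: "'a::euclidean_space"
  assumes "0 \<le> l"
  shows "diameter (cube a l) = l * sqrt DIM('a)"
  using assms by (simp add: cube_def diameter_cbox inner_add_left dist_norm norm_One)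

lemma cube_translation: "(+) h ` cube a l = cube (h + a) l"
  unfolding cube_def cbox_translation[symmetric] by (simp add: add.assoc)

definition grid_cell :: "real \<Rightarrow> 'a::euclidean_space \<Rightarrow> 'a set" where
  "grid_cell l x = {y. \<forall>b\<in>Basis. \<lfloor>y \<bullet> b / l\<rfloor> = \<lfloor>x \<bullet> b / l\<rfloor>}"

definition grid_corner :: "real \<Rightarrow> 'a::euclidean_space \<Rightarrow> 'a" where
  "grid_corner l x = (\<Sum>b\<in>Basis. (l * of_int \<lfloor>x \<bullet> b / l\<rfloor>) *\<^sub>R b)"

lemma grid_cell_self [simp]: "x \<in> grid_cell l x"
  by (simp add: grid_cell_def)

lemma grid_cell_eq: "y \<in> grid_cell l x \<Longrightarrow> grid_cell l y = grid_cell l x"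
  by (simp add: grid_cell_def)

lemma grid_cell_half_subset: "grid_cell (l / 2) x \<subseteq> grid_cell l x"
proof -
  have floor_half: "\<lfloor>r / l\<rfloor> = \<lfloor>r / (l / 2)\<rfloor> div 2" for r
    using floor_divide_real_eq_div[of 2 "r / (l / 2)"] by simp
  show ?thesis
    unfolding grid_cell_def floor_half by auto
qed

lemma grid_cell_dyadic_antimono:
  "j \<le> k \<Longrightarrow> grid_cell (L / 2 ^ k) x \<subseteq> grid_cell (L / 2 ^ j) x"
proof (induction k rule: dec_induct)
  case (step k)
  have "grid_cell (L / 2 ^ Suc k) x \<subseteq> grid_cell (L / 2 ^ k) x"
    using grid_cell_half_subset[of "L / 2 ^ k" x] by (simp add: mult.commute)
  with step.IH show ?case by blast
qed simp

lemma countable_grid_cells: "countable (range (grid_cell l :: 'a::euclidean_space \<Rightarrow> 'a set))"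
proof -
  define F where "F m = {y :: 'a. \<forall>b\<in>Basis. \<lfloor>y \<bullet> b / l\<rfloor> = m b}" for m
  have "grid_cell l x = F (\<lambda>b\<in>Basis. \<lfloor>x \<bullet> b / l\<rfloor>)" for x :: 'a
    by (simp add: grid_cell_def F_def)
  then have "range (grid_cell l) \<subseteq> F ` (Basis \<rightarrow>\<^sub>E UNIV)"
    by auto
  moreover have "countable ((Basis :: 'a set) \<rightarrow>\<^sub>E (UNIV :: int set))"
    by (intro countable_PiE) auto
  ultimately show ?thesis
    by (meson countable_image countable_subset)
qed

lemma sets_grid_cell [measurable, simp]: "grid_cell l x \<in> sets lebesgue"
proof -
  have "{y \<in> space borel. \<forall>b\<in>Basis. \<lfloor>y \<bullet> b / l\<rfloor> = \<lfloor>x \<bullet> b / l\<rfloor>} \<in> sets borel"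
    by measurable
  then show ?thesis
    by (simp add: grid_cell_def)
qed

lemma mem_grid_cell_iff:
  fixes x :: "'a::euclidean_space"
  assumes "0 < l"
  shows "y \<in> grid_cell l x \<longleftrightarrow>
    (\<forall>b\<in>Basis. grid_corner l x \<bullet> b \<le> y \<bullet> b \<and> y \<bullet> b < grid_corner l x \<bullet> b + l)"
  using assms
  by (simp add: grid_cell_def grid_corner_def inner_sum_left_Basis floor_eq_iff field_simps)

lemma grid_cell_subset_cube: "0 < l \<Longrightarrow> grid_cell l x \<subseteq> cube (grid_corner l x) l"
  by (auto simp: mem_grid_cell_iff cube_def mem_box inner_add_left less_imp_le)

lemma emeasure_grid_cell:
  fixes x :: "'a::euclidean_space"
  assumes "0 < l"
  shows "emeasure lebesgue (grid_cell l x) = ennreal (l ^ DIM('a))"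
proof (rule antisym)
  let ?a = "grid_corner l x"
  have "emeasure lebesgue (grid_cell l x) \<le> emeasure lebesgue (cube ?a l)"
    using assms by (intro emeasure_mono grid_cell_subset_cube) auto
  then show "emeasure lebesgue (grid_cell l x) \<le> ennreal (l ^ DIM('a))"
    using assms by (metis emeasure_cube less_imp_le)
  have "ennreal (l ^ DIM('a)) = emeasure lebesgue (box ?a (?a + l *\<^sub>R One))"
    using assms by (simp add: emeasure_completion emeasure_lborel_box_eq inner_add_left)
  also have "\<dots> \<le> emeasure lebesgue (grid_cell l x)"
    using assms
    by (intro emeasure_mono)
       (auto simp: mem_grid_cell_iff mem_box inner_add_left less_imp_le)
  finally show "ennreal (l ^ DIM('a)) \<le> emeasure lebesgue (grid_cell l x)" .
qed

lemma dyadic_grid_cell_subset_open: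
  fixes x :: "'a::euclidean_space"
  assumes "0 < L" "open G" "x \<in> G"
  obtains k where "grid_cell (L / 2 ^ k) x \<subseteq> G"
proof -
  obtain e where ball_subset: "0 < e" "ball x e \<subseteq> G"
    using assms(2,3) open_contains_ball by blast
  obtain k where "(L * sqrt DIM('a)) / e < 2 ^ k"
    using real_arch_pow[of 2] by auto
  then have small_side: "L / 2 ^ k * sqrt DIM('a) < e"
    using ball_subset by (simp add: field_simps)
  have "dist x y < e" if "y \<in> grid_cell (L / 2 ^ k) x" for y
  proof -
    define C where "C = cube (grid_corner (L / 2 ^ k) x) (L / 2 ^ k)"
    have "{x, y} \<subseteq> C"
      using that grid_cell_subset_cube[of "L / 2 ^ k" x] assms(1) by (auto simp: C_def)
    then have "dist x y \<le> diameter C"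
      by (intro diameter_bounded_bound) (auto simp: C_def cube_def)
    also have "\<dots> < e"
      using small_side assms(1) by (simp add: C_def diameter_cube)
    finally show ?thesis .
  qed
  with ball_subset that show thesis
    by (metis mem_ball subset_iff)
qed

section \<open>Calderon--Zygmund stopping cells\<close>

definition stopping_cells :: "real \<Rightarrow> ('a::euclidean_space set \<Rightarrow> bool) \<Rightarrow> 'a set set" where
  "stopping_cells L P = {grid_cell (L / 2 ^ k) x | k x.
     P (grid_cell (L / 2 ^ k) x) \<and> (\<forall>j<k. \<not> P (grid_cell (L / 2 ^ j) x))}"

lemma stopping_cell_containing:
  assumes "Q \<in> stopping_cells L P" "y \<in> Q"
  shows "Q = grid_cell (L / 2 ^ (LEAST k. P (grid_cell (L / 2 ^ k) y))) y"
proof -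
  obtain k x where Q_eq: "Q = grid_cell (L / 2 ^ k) x" "P Q"
    and before: "\<And>j. j < k \<Longrightarrow> \<not> P (grid_cell (L / 2 ^ j) x)"
    using assms(1) by (auto simp: stopping_cells_def)
  have same_cell: "grid_cell (L / 2 ^ j) y = grid_cell (L / 2 ^ j) x" if "j \<le> k" for j
    using grid_cell_dyadic_antimono[OF that, of L x] assms(2) Q_eq(1) by (intro grid_cell_eq) auto
  have "(LEAST k. P (grid_cell (L / 2 ^ k) y)) = k"
  proof (rule Least_equality)
    show "P (grid_cell (L / 2 ^ k) y)"
      using Q_eq same_cell by simp
    show "k \<le> j" if "P (grid_cell (L / 2 ^ j) y)" for j
      using that before[of j] same_cell[of j] by (cases "j < k") auto
  qed
  with Q_eq same_cell show ?thesis by simp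
qed

lemma disjoint_stopping_cells: "disjoint (stopping_cells L P)"
  by (rule disjointI) (use stopping_cell_containing in blast)

lemma countable_stopping_cells: "countable (stopping_cells L P)"
  by (rule countable_subset[of _ "\<Union>k. range (grid_cell (L / 2 ^ k))"])
     (auto simp: stopping_cells_def countable_grid_cells)

lemma sets_stopping_cells: "stopping_cells L P \<subseteq> sets lebesgue"
  by (auto simp: stopping_cells_def)

lemma mem_Union_stopping_cells_iff:
  "x \<in> \<Union> (stopping_cells L P) \<longleftrightarrow> (\<exists>k. P (grid_cell (L / 2 ^ k) x))"
proof
  assume "x \<in> \<Union> (stopping_cells L P)"
  then show "\<exists>k. P (grid_cell (L / 2 ^ k) x)"
    unfolding stopping_cells_def by auto (metis grid_cell_eq)
next
  assume stops: "\<exists>k. P (grid_cell (L / 2 ^ k) x)"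
  define k where "k = (LEAST k. P (grid_cell (L / 2 ^ k) x))"
  have "P (grid_cell (L / 2 ^ k) x)" "\<forall>j<k. \<not> P (grid_cell (L / 2 ^ j) x)"
    unfolding k_def using LeastI_ex[OF stops] not_less_Least by blast+
  then show "x \<in> \<Union> (stopping_cells L P)"
    unfolding stopping_cells_def using grid_cell_self by blast
qed

text \<open>A weak form of the Lebesgue density theorem, with dyadic cells in place of balls.\<close>

lemma null_sets_if_low_dyadic_density:
  fixes F :: "'a::euclidean_space set"
  assumes F_meas: "F \<in> lmeasurable" and L_pos: "0 < L" and \<tau>_bounds: "0 \<le> \<tau>" "\<tau> < 1"
    and density: "\<And>x k. x \<in> F \<Longrightarrow>
      emeasure lebesgue (F \<inter> grid_cell (L / 2 ^ k) x)
        \<le> ennreal \<tau> * emeasure lebesgue (grid_cell (L / 2 ^ k) x)"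
  shows "F \<in> null_sets lebesgue"
proof (rule ccontr)
  assume "F \<notin> null_sets lebesgue"
  then have "emeasure lebesgue F \<noteq> 0"
    using F_meas by (auto simp: null_sets_def)
  then obtain G where G_cover: "open G" "F \<subseteq> G" "ennreal \<tau> * emeasure lebesgue G < emeasure lebesgue F"
    using outer_open_scaled_emeasure_less[OF F_meas _ \<tau>_bounds] by blast
  define \<Q> where "\<Q> = stopping_cells L (\<lambda>Q. Q \<subseteq> G)"
  have "F \<subseteq> \<Union>\<Q>"
    unfolding \<Q>_def subset_iff mem_Union_stopping_cells_iff
    using G_cover dyadic_grid_cell_subset_open[OF L_pos] by (metis subsetD)
  have cell_density_le: "1 * emeasure lebesgue (F \<inter> Q) \<le> ennreal \<tau> * emeasure lebesgue (G \<inter> Q)"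
    if "Q \<in> \<Q>" for Q
  proof (cases "F \<inter> Q = {}")
    case False
    then obtain x where x_mem: "x \<in> F" "x \<in> Q" by blast
    with that obtain k where "Q = grid_cell (L / 2 ^ k) x"
      unfolding \<Q>_def using stopping_cell_containing by blast
    moreover have "G \<inter> Q = Q"
      using that by (auto simp: \<Q>_def stopping_cells_def)
    ultimately show ?thesis
      using density[OF x_mem(1)] by simp
  qed simp
  have "1 * emeasure lebesgue (F \<inter> \<Union>\<Q>) \<le> ennreal \<tau> * emeasure lebesgue (G \<inter> \<Union>\<Q>)"
  proof (rule emeasure_Int_Union_disjoint_mono)
    show "countable \<Q>" "disjoint \<Q>" "\<Q> \<subseteq> sets lebesgue"
      unfolding \<Q>_def by (rule countable_stopping_cells disjoint_stopping_cells sets_stopping_cells)+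
  qed (use F_meas G_cover cell_density_le in auto)
  also have "\<dots> \<le> ennreal \<tau> * emeasure lebesgue G"
    using G_cover(1) by (intro mult_left_mono emeasure_mono) auto
  finally show False
    using G_cover(3) \<open>F \<subseteq> \<Union>\<Q>\<close> by (simp add: Int_absorb2)
qed

lemma stopping_cell_density_le:
  fixes E :: "'a::euclidean_space set"
  assumes L_pos: "0 < L" and E_sets: "E \<in> sets lebesgue" and \<tau>_nonneg: "0 \<le> \<tau>"
    and small: "emeasure lebesgue E \<le> ennreal (\<tau> * L ^ DIM('a))"
    and Q_stopping: "Q \<in> stopping_cells L (\<lambda>Q. ennreal \<tau> * emeasure lebesgue Q < emeasure lebesgue (E \<inter> Q))"
  obtains l x where "0 < l" "l \<le> L" "Q = grid_cell l x"
    "emeasure lebesgue (E \<inter> Q) \<le> ennreal (2 ^ DIM('a) * \<tau>) * emeasure lebesgue Q"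
proof -
  obtain k x where Q_eq: "Q = grid_cell (L / 2 ^ k) x"
    "ennreal \<tau> * emeasure lebesgue Q < emeasure lebesgue (E \<inter> Q)"
    and before: "\<And>j. j < k \<Longrightarrow> emeasure lebesgue (E \<inter> grid_cell (L / 2 ^ j) x)
      \<le> ennreal \<tau> * emeasure lebesgue (grid_cell (L / 2 ^ j) x)"
    using Q_stopping by (auto simp: stopping_cells_def not_less)
  have "k \<noteq> 0"
  proof
    assume "k = 0"
    have "emeasure lebesgue (E \<inter> Q) \<le> emeasure lebesgue E"
      using E_sets by (intro emeasure_mono) auto
    also have "\<dots> \<le> ennreal \<tau> * emeasure lebesgue Q"
      using small L_pos \<tau>_nonneg \<open>k = 0\<close> unfolding Q_eq(1)
      by (subst emeasure_grid_cell) (auto simp: ennreal_mult)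
    finally show False
      using Q_eq(2) by simp
  qed
  then obtain j where k_eq: "k = Suc j"
    using not0_implies_Suc by blast
  have "emeasure lebesgue (E \<inter> Q) \<le> emeasure lebesgue (E \<inter> grid_cell (L / 2 ^ j) x)"
    using E_sets grid_cell_dyadic_antimono[of j k L x] k_eq by (intro emeasure_mono) (auto simp: Q_eq(1))
  also have "\<dots> \<le> ennreal \<tau> * ennreal ((L / 2 ^ j) ^ DIM('a))"
    using before[of j] k_eq L_pos by (simp add: emeasure_grid_cell)
  also have "\<dots> = ennreal (2 ^ DIM('a) * \<tau>) * ennreal ((L / 2 ^ k) ^ DIM('a))"
    using L_pos \<tau>_nonneg by (simp add: k_eq ennreal_mult'[symmetric] power_divide power_mult_distrib)
  also have "ennreal ((L / 2 ^ k) ^ DIM('a)) = emeasure lebesgue Q"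
    unfolding Q_eq(1) using L_pos by (intro emeasure_grid_cell[symmetric]) simp
  finally show thesis
    using that[of "L / 2 ^ k" x] L_pos Q_eq(1) by (simp add: divide_le_eq)
qed

lemma Calderon_Zygmund_covering:
  fixes E :: "'a::euclidean_space set"
  assumes L_pos: "0 < L" and E_sets: "E \<in> sets lebesgue" and \<tau>_bounds: "0 \<le> \<tau>" "\<tau> < 1"
    and small: "emeasure lebesgue E \<le> ennreal (\<tau> * L ^ DIM('a))"
  obtains \<Q> where "countable \<Q>" "disjoint \<Q>" "\<Q> \<subseteq> sets lebesgue" "E - \<Union>\<Q> \<in> null_sets lebesgue"
    "\<And>Q. Q \<in> \<Q> \<Longrightarrow> \<exists>l x. 0 < l \<and> l \<le> L \<and> Q = grid_cell l x"
    "\<And>Q. Q \<in> \<Q> \<Longrightarrow> ennreal \<tau> * emeasure lebesgue Q \<le> emeasure lebesgue (E \<inter> Q)"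
    "\<And>Q. Q \<in> \<Q> \<Longrightarrow> emeasure lebesgue (E \<inter> Q) \<le> ennreal (2 ^ DIM('a) * \<tau>) * emeasure lebesgue Q"
proof
  let ?dense = "\<lambda>Q. ennreal \<tau> * emeasure lebesgue Q < emeasure lebesgue (E \<inter> Q)"
  let ?\<Q> = "stopping_cells L ?dense"
  show family: "countable ?\<Q>" "disjoint ?\<Q>" "?\<Q> \<subseteq> sets lebesgue"
    by (rule countable_stopping_cells disjoint_stopping_cells sets_stopping_cells)+
  have E_finite: "E \<in> lmeasurable"
    using E_sets small by (intro fmeasurableI) (auto simp: le_less_trans)
  show "E - \<Union>?\<Q> \<in> null_sets lebesgue" (is "?F \<in> _")
  proof (rule null_sets_if_low_dyadic_density[OF _ L_pos \<tau>_bounds])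
    show "?F \<in> lmeasurable"
      using E_finite family by (intro fmeasurable.Diff fmeasurable_Diff sets.countable_Union) auto
    fix x k assume "x \<in> ?F"
    then have "\<not> ?dense (grid_cell (L / 2 ^ k) x)"
      unfolding Diff_iff mem_Union_stopping_cells_iff by blast
    moreover have "emeasure lebesgue (?F \<inter> grid_cell (L / 2 ^ k) x)
        \<le> emeasure lebesgue (E \<inter> grid_cell (L / 2 ^ k) x)"
      using E_sets by (intro emeasure_mono) auto
    ultimately show "emeasure lebesgue (?F \<inter> grid_cell (L / 2 ^ k) x)
        \<le> ennreal \<tau> * emeasure lebesgue (grid_cell (L / 2 ^ k) x)"
      by simp
  qed
  fix Q assume Q_stopping: "Q \<in> ?\<Q>"
  show "\<exists>l x. 0 < l \<and> l \<le> L \<and> Q = grid_cell l x"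
    and "emeasure lebesgue (E \<inter> Q) \<le> ennreal (2 ^ DIM('a) * \<tau>) * emeasure lebesgue Q"
    by (rule stopping_cell_density_le[OF L_pos E_sets \<tau>_bounds(1) small Q_stopping]; blast)+
  show "ennreal \<tau> * emeasure lebesgue Q \<le> emeasure lebesgue (E \<inter> Q)"
    using Q_stopping by (auto simp: stopping_cells_def less_imp_le)
qed

section \<open>Mean oscillation\<close>

lemma is_cube_iff:
  fixes C :: "(real^'n) set"
  shows "is_cube C \<longleftrightarrow> (\<exists>a l. 0 < l \<and> C = cube a l)"
proof -
  have "{x. \<forall>i. x $ i \<in> {a $ i .. a $ i + l}} = cube a l" for a :: "real^'n" and l
    by (auto simp: cube_def mem_box_cart cart_eq_inner_axis inner_add_left)
  then show ?thesis
    by (simp only: is_cube_def)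
qed

lemma is_cube_sets: "is_cube C \<Longrightarrow> C \<in> sets lebesgue"
  by (auto simp: is_cube_iff)

lemma is_cube_translation: "is_cube C \<Longrightarrow> is_cube ((+) h ` C)"
  unfolding is_cube_iff using cube_translation by blast

lemma diameter_translation: "diameter ((+) h ` S) = diameter (S :: 'a::real_normed_vector set)"
proof -
  have "(\<lambda>(x, y). dist x y) ` (((+) h ` S) \<times> ((+) h ` S)) = (\<lambda>(x, y). dist x y) ` (S \<times> S)"
    by (force simp: image_iff)
  then show ?thesis
    by (simp add: diameter_def)
qed

lemma mean_oscillation_diff_le:
  fixes u v :: "real^'n \<Rightarrow> real"
  assumes [measurable]: "u \<in> borel_measurable lebesgue" "v \<in> borel_measurable lebesgue" "C \<in> sets lebesgue"
  shows "mean_oscillation (\<lambda>x. v x - u x) C \<le> mean_oscillation v C + mean_oscillation u C"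
proof -
  let ?osc = "\<lambda>f x. \<integral>\<^sup>+z\<in>C. ennreal \<bar>f z - f x\<bar> \<partial>lebesgue"
  have inner_le: "?osc (\<lambda>x. v x - u x) x \<le> ?osc v x + ?osc u x" for x
  proof -
    have "?osc (\<lambda>x. v x - u x) x
        \<le> (\<integral>\<^sup>+z. ennreal \<bar>v z - v x\<bar> * indicator C z + ennreal \<bar>u z - u x\<bar> * indicator C z \<partial>lebesgue)"
      by (intro nn_integral_mono)
         (auto simp: indicator_def ennreal_plus[symmetric] simp del: ennreal_plus intro!: ennreal_leI)
    also have "\<dots> = ?osc v x + ?osc u x"
      by (intro nn_integral_add) measurable
    finally show ?thesis .
  qed
  have "(\<integral>\<^sup>+x\<in>C. ?osc (\<lambda>x. v x - u x) x \<partial>lebesgue)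
      \<le> (\<integral>\<^sup>+x. ?osc v x * indicator C x + ?osc u x * indicator C x \<partial>lebesgue)"
    using inner_le by (intro nn_integral_mono) (auto simp: indicator_def)
  also have "\<dots> = (\<integral>\<^sup>+x\<in>C. ?osc v x \<partial>lebesgue) + (\<integral>\<^sup>+x\<in>C. ?osc u x \<partial>lebesgue)"
    by (intro nn_integral_add) measurable
  finally show ?thesis
    unfolding mean_oscillation_def add_divide_distrib_ennreal[symmetric]
    by (rule divide_right_mono_ennreal)
qed

lemma mean_oscillation_translation:
  fixes u :: "real^'n \<Rightarrow> real"
  assumes [measurable]: "u \<in> borel_measurable lebesgue" and C_sets: "(+) h ` C \<in> sets lebesgue"
  shows "mean_oscillation (\<lambda>x. u (x + h)) C = mean_oscillation u ((+) h ` C)"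
proof -
  note [measurable] = C_sets
  have indicator_shift: "indicator C x = (indicator ((+) h ` C) (x + h) :: ennreal)" for x
    by (auto simp: indicator_def)
  have inner_shift: "(\<integral>\<^sup>+z\<in>C. ennreal \<bar>u (z + h) - c\<bar> \<partial>lebesgue)
      = (\<integral>\<^sup>+z\<in>(+) h ` C. ennreal \<bar>u z - c\<bar> \<partial>lebesgue)" for c
    unfolding indicator_shift by (rule nn_integral_lebesgue_translation) measurable
  have "(\<integral>\<^sup>+x\<in>C. (\<integral>\<^sup>+z\<in>C. ennreal \<bar>u (z + h) - u (x + h)\<bar> \<partial>lebesgue) \<partial>lebesgue)
      = (\<integral>\<^sup>+x\<in>(+) h ` C. (\<integral>\<^sup>+z\<in>(+) h ` C. ennreal \<bar>u z - u x\<bar> \<partial>lebesgue) \<partial>lebesgue)"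
    unfolding inner_shift unfolding indicator_shift by (rule nn_integral_lebesgue_translation) measurable
  then show ?thesis
    by (simp add: mean_oscillation_def emeasure_lebesgue_translation)
qed

lemma emeasure_times_le_mean_oscillation:
  fixes u :: "real^'n \<Rightarrow> real"
  assumes [measurable]: "A \<in> sets lebesgue" "B \<in> sets lebesgue"
    and "A \<subseteq> C" "B \<subseteq> C" and C_emeasure: "emeasure lebesgue C = ennreal v" "0 < v"
    and gap: "\<And>x z. x \<in> A \<Longrightarrow> z \<in> B \<Longrightarrow> s \<le> \<bar>u z - u x\<bar>"
  shows "ennreal s * emeasure lebesgue B * emeasure lebesgue A \<le> mean_oscillation u C * (ennreal v)\<^sup>2"
proof -
  have "ennreal s * emeasure lebesgue B * emeasure lebesgue A
      = (\<integral>\<^sup>+x\<in>A. (\<integral>\<^sup>+z\<in>B. ennreal s \<partial>lebesgue) \<partial>lebesgue)"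
    by (simp add: nn_integral_cmult_indicator)
  also have "\<dots> \<le> (\<integral>\<^sup>+x\<in>C. (\<integral>\<^sup>+z\<in>C. ennreal \<bar>u z - u x\<bar> \<partial>lebesgue) \<partial>lebesgue)"
  proof (rule nn_integral_mono)
    fix x
    have "(\<integral>\<^sup>+z\<in>B. ennreal s \<partial>lebesgue) \<le> (\<integral>\<^sup>+z\<in>C. ennreal \<bar>u z - u x\<bar> \<partial>lebesgue)" if "x \<in> A"
      using gap[OF that] \<open>B \<subseteq> C\<close>
      by (intro nn_integral_mono) (auto simp: indicator_def intro!: ennreal_leI)
    then show "(\<integral>\<^sup>+z\<in>B. ennreal s \<partial>lebesgue) * indicator A x
        \<le> (\<integral>\<^sup>+z\<in>C. ennreal \<bar>u z - u x\<bar> \<partial>lebesgue) * indicator C x"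
      using \<open>A \<subseteq> C\<close> by (auto simp: indicator_def)
  qed
  also have "\<dots> = mean_oscillation u C * (ennreal v)\<^sup>2"
    using C_emeasure(2) unfolding mean_oscillation_def C_emeasure(1)
    by (simp add: ennreal_divide_times ennreal_power)
  finally show ?thesis .
qed

definition oscillation_modulus :: "(real^'n \<Rightarrow> real) \<Rightarrow> real \<Rightarrow> ennreal" where
  "oscillation_modulus u R = (SUP C\<in>{C. is_cube C \<and> diameter C \<le> R}. mean_oscillation u C)"

lemma mean_oscillation_le_modulus:
  "is_cube C \<Longrightarrow> diameter C \<le> R \<Longrightarrow> mean_oscillation u C \<le> oscillation_modulus u R"
  unfolding oscillation_modulus_def by (rule SUP_upper) simp

lemma oscillation_modulus_increment_le:
  fixes u :: "real^'n \<Rightarrow> real"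
  assumes u_meas [measurable]: "u \<in> borel_measurable lebesgue"
  shows "oscillation_modulus (\<lambda>x. u (x + h) - u x) R \<le> 2 * oscillation_modulus u R"
  unfolding oscillation_modulus_def[of "\<lambda>x. u (x + h) - u x"]
proof (rule SUP_least, clarify)
  fix C :: "(real^'n) set" assume C_cube: "is_cube C" "diameter C \<le> R"
  have "mean_oscillation (\<lambda>x. u (x + h) - u x) C
      \<le> mean_oscillation (\<lambda>x. u (x + h)) C + mean_oscillation u C"
    using is_cube_sets[OF C_cube(1)] by (intro mean_oscillation_diff_le) measurable
  also have "mean_oscillation (\<lambda>x. u (x + h)) C = mean_oscillation u ((+) h ` C)"
    using C_cube by (intro mean_oscillation_translation u_meas is_cube_sets is_cube_translation)
  also have "\<dots> + mean_oscillation u C \<le> oscillation_modulus u R + oscillation_modulus u R"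
    using C_cube by (intro add_mono mean_oscillation_le_modulus)
      (auto simp: is_cube_translation diameter_translation)
  finally show "mean_oscillation (\<lambda>x. u (x + h) - u x) C \<le> 2 * oscillation_modulus u R"
    by (simp add: mult_2)
qed

section \<open>The good-\<open>\<lambda>\<close> inequality\<close>

definition superlevel :: "('a \<Rightarrow> real) \<Rightarrow> real \<Rightarrow> 'a set" where
  "superlevel f t = {x. t < \<bar>f x\<bar>}"

lemma sets_superlevel [measurable (raw)]:
  fixes f :: "'a::euclidean_space \<Rightarrow> real"
  assumes [measurable]: "f \<in> borel_measurable lebesgue"
  shows "superlevel f t \<in> sets lebesgue"
proof -
  have "{x \<in> space lebesgue. t < \<bar>f x\<bar>} \<in> sets lebesgue"
    by measurable
  then show ?thesis
    by (simp add: superlevel_def)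
qed

lemma superlevel_antimono: "s \<le> t \<Longrightarrow> superlevel f t \<subseteq> superlevel f s"
  by (auto simp: superlevel_def)

lemma emeasure_superlevel_antimono:
  fixes f :: "'a::euclidean_space \<Rightarrow> real"
  assumes "f \<in> borel_measurable lebesgue" "s \<le> t"
  shows "emeasure lebesgue (superlevel f t) \<le> emeasure lebesgue (superlevel f s)"
  using assms by (intro emeasure_mono superlevel_antimono sets_superlevel)

text \<open>At least half of the points of \<open>Q\<close> satisfy \<open>\<bar>w\<bar> \<le> t\<close>, and at each of them \<open>w\<close> differs by at least
  \<open>s\<close> from its value at any point where \<open>\<bar>w\<bar> > t + s\<close>.\<close>

lemma emeasure_superlevel_Int_le_mean_oscillation:
  fixes w :: "real^'n \<Rightarrow> real"
  assumes w_meas [measurable]: "w \<in> borel_measurable lebesgue" and Q_sets [measurable]: "Q \<in> sets lebesgue"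
    and Q_C: "Q \<subseteq> C" "emeasure lebesgue Q = ennreal v" "emeasure lebesgue C = ennreal v" "0 < v"
    and half: "emeasure lebesgue (superlevel w t \<inter> Q) \<le> ennreal (1 / 2) * emeasure lebesgue Q"
  shows "ennreal s * emeasure lebesgue (superlevel w (t + s) \<inter> Q)
    \<le> 2 * mean_oscillation w C * emeasure lebesgue Q"
proof -
  let ?E = "superlevel w t" and ?A = "superlevel w (t + s) \<inter> Q"
  have "emeasure lebesgue Q = emeasure lebesgue (Q - ?E) + emeasure lebesgue (?E \<inter> Q)"
    by (subst plus_emeasure) (auto intro!: arg_cong[where f = "emeasure lebesgue"])
  also note half
  also have "ennreal (1 / 2) * emeasure lebesgue Q = ennreal (v / 2)"
    unfolding Q_C(2) by (subst ennreal_mult'[symmetric]) auto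
  finally have "ennreal v \<le> emeasure lebesgue (Q - ?E) + ennreal (v / 2)"
    unfolding Q_C(2) by (simp add: add_left_mono)
  then have complement: "ennreal (v / 2) \<le> emeasure lebesgue (Q - ?E)"
    using Q_C(4) by (cases "emeasure lebesgue (Q - ?E)") (auto simp flip: ennreal_plus)
  have gap: "s \<le> \<bar>w z - w x\<bar>" if "x \<in> ?A" "z \<in> Q - ?E" for x z
    using that by (auto simp: superlevel_def)
  have "ennreal (v / 2) * (ennreal s * emeasure lebesgue ?A)
      \<le> emeasure lebesgue (Q - ?E) * (ennreal s * emeasure lebesgue ?A)"
    using complement by (rule mult_right_mono) simp
  also have "\<dots> = ennreal s * emeasure lebesgue (Q - ?E) * emeasure lebesgue ?A"
    by (simp only: mult_ac)
  also have "\<dots> \<le> mean_oscillation w C * (ennreal v)\<^sup>2"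
    using Q_C gap by (intro emeasure_times_le_mean_oscillation) auto
  also have "\<dots> = ennreal (v / 2) * (2 * mean_oscillation w C * ennreal v)"
  proof -
    have "ennreal v = ennreal (v / 2) * 2"
      using Q_C(4) by (simp add: ennreal_mult'[symmetric] flip: ennreal_numeral)
    then show ?thesis
      by (simp add: power2_eq_square mult_ac)
  qed
  finally show ?thesis
    using Q_C by (simp add: ennreal_mult_le_mult_iff)
qed

lemma good_lambda_grid_cell:
  fixes w :: "real^'n \<Rightarrow> real" and x :: "real^'n"
  defines "\<tau> \<equiv> 1 / 2 ^ Suc CARD('n)"
  assumes w_meas: "w \<in> borel_measurable lebesgue" and l_pos: "0 < l" and diam: "l * sqrt CARD('n) \<le> R"
    and dense: "ennreal \<tau> * emeasure lebesgue (grid_cell l x)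
      \<le> emeasure lebesgue (superlevel w t \<inter> grid_cell l x)"
    and sparse: "emeasure lebesgue (superlevel w t \<inter> grid_cell l x)
      \<le> ennreal (1 / 2) * emeasure lebesgue (grid_cell l x)"
  shows "ennreal s * emeasure lebesgue (superlevel w (t + s) \<inter> grid_cell l x)
    \<le> ennreal (2 ^ (CARD('n) + 2)) * oscillation_modulus w R
      * emeasure lebesgue (superlevel w t \<inter> grid_cell l x)"
proof -
  let ?n = "CARD('n)" and ?Q = "grid_cell l x" and ?C = "cube (grid_corner l x) l"
  let ?\<omega> = "oscillation_modulus w R"
  have cube_small: "is_cube ?C" "diameter ?C \<le> R"
    using l_pos diam by (auto simp: is_cube_iff diameter_cube)
  have "ennreal s * emeasure lebesgue (superlevel w (t + s) \<inter> ?Q)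
      \<le> 2 * mean_oscillation w ?C * emeasure lebesgue ?Q"
    using l_pos emeasure_grid_cell[OF l_pos, of x] emeasure_cube[of l "grid_corner l x"]
    by (intro emeasure_superlevel_Int_le_mean_oscillation[where v = "l ^ ?n"] w_meas sparse)
       (auto simp: grid_cell_subset_cube)
  also have "\<dots> \<le> 2 * ?\<omega> * emeasure lebesgue ?Q"
    using mean_oscillation_le_modulus[OF cube_small] by (intro mult_right_mono mult_left_mono) auto
  also have "emeasure lebesgue ?Q = ennreal (2 ^ Suc ?n) * (ennreal \<tau> * emeasure lebesgue ?Q)"
    by (simp add: \<tau>_def ennreal_mult'[symmetric] mult.assoc[symmetric])
  also have "2 * ?\<omega> * \<dots> \<le> 2 * ?\<omega> * (ennreal (2 ^ Suc ?n) * emeasure lebesgue (superlevel w t \<inter> ?Q))"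
    using dense by (intro mult_left_mono) auto
  also have "\<dots> = ennreal (2 ^ (?n + 2)) * ?\<omega> * emeasure lebesgue (superlevel w t \<inter> ?Q)"
    by (simp add: ennreal_mult mult_ac)
  finally show ?thesis .
qed

lemma good_lambda:
  fixes w :: "real^'n \<Rightarrow> real"
  assumes w_meas: "w \<in> borel_measurable lebesgue" and L_pos: "0 < L" and s_nonneg: "0 \<le> s"
    and small: "emeasure lebesgue (superlevel w t) \<le> ennreal (L ^ CARD('n) / 2 ^ Suc CARD('n))"
  shows "ennreal s * emeasure lebesgue (superlevel w (t + s))
    \<le> ennreal (2 ^ (CARD('n) + 2)) * oscillation_modulus w (L * sqrt CARD('n))
      * emeasure lebesgue (superlevel w t)"
proof -
  let ?n = "CARD('n)" and ?E = "superlevel w t" and ?A = "superlevel w (t + s)"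
  let ?c = "ennreal (2 ^ (?n + 2)) * oscillation_modulus w (L * sqrt ?n)"
  define \<tau> :: real where "\<tau> = 1 / 2 ^ Suc ?n"
  have \<tau>_bounds: "0 \<le> \<tau>" "\<tau> < 1" "2 ^ ?n * \<tau> = 1 / 2"
    by (auto simp: \<tau>_def field_simps intro: less_le_trans[of _ 2])
  have sets: "?E \<in> sets lebesgue" "?A \<in> sets lebesgue"
    by (rule sets_superlevel[OF w_meas])+
  obtain \<Q> where family: "countable \<Q>" "disjoint \<Q>" "\<Q> \<subseteq> sets lebesgue" "?E - \<Union>\<Q> \<in> null_sets lebesgue"
    and cells: "\<And>Q. Q \<in> \<Q> \<Longrightarrow> \<exists>l x. 0 < l \<and> l \<le> L \<and> Q = grid_cell l x"
    and dense: "\<And>Q. Q \<in> \<Q> \<Longrightarrow> ennreal \<tau> * emeasure lebesgue Q \<le> emeasure lebesgue (?E \<inter> Q)"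
    and sparse: "\<And>Q. Q \<in> \<Q> \<Longrightarrow> emeasure lebesgue (?E \<inter> Q) \<le> ennreal (1 / 2) * emeasure lebesgue Q"
    using Calderon_Zygmund_covering[OF L_pos sets(1) \<tau>_bounds(1,2)] small \<tau>_bounds(3)
    by (auto simp: \<tau>_def)
  have on_cells: "ennreal s * emeasure lebesgue (?A \<inter> Q) \<le> ?c * emeasure lebesgue (?E \<inter> Q)"
    if "Q \<in> \<Q>" for Q
  proof -
    from cells[OF that] obtain l x where Q_eq: "0 < l" "l \<le> L" "Q = grid_cell l x"
      by blast
    show ?thesis
      using Q_eq dense[OF that] sparse[OF that] unfolding Q_eq(3) \<tau>_def
      by (intro good_lambda_grid_cell w_meas) (auto intro: mult_right_mono)
  qed
  have "?A - \<Union>\<Q> \<in> null_sets lebesgue"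
    using family sets superlevel_antimono[of t "t + s" w] s_nonneg
    by (intro null_sets_subset[OF family(4)] sets.Diff sets.countable_Union) auto
  then have "emeasure lebesgue ?A = emeasure lebesgue (?A \<inter> \<Union>\<Q>)"
    using emeasure_Un_null_set[of "?A \<inter> \<Union>\<Q>" lebesgue "?A - \<Union>\<Q>"] sets family
    by (simp add: Int_Diff_Un sets.countable_Union sets.Int)
  then have "ennreal s * emeasure lebesgue ?A \<le> ?c * emeasure lebesgue (?E \<inter> \<Union>\<Q>)"
    using emeasure_Int_Union_disjoint_mono[OF family(1-3) sets(2,1) on_cells] by simp
  also have "\<dots> \<le> ?c * emeasure lebesgue ?E"
    using sets(1) by (intro mult_left_mono emeasure_mono) auto
  finally show ?thesis .
qed

lemma superlevel_dyadic_decay: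
  fixes w :: "real^'n \<Rightarrow> real"
  assumes w_meas: "w \<in> borel_measurable lebesgue" and L_pos: "0 < L"
    and \<delta>_pos: "0 < \<delta>" and \<theta>_nonneg: "0 \<le> \<theta>"
    and osc: "oscillation_modulus w (L * sqrt CARD('n)) \<le> ennreal (\<delta> * \<theta> / 2 ^ (CARD('n) + 2))"
    and small: "emeasure lebesgue (superlevel w \<delta>) \<le> ennreal (L ^ CARD('n) / 2 ^ Suc CARD('n))"
  shows "emeasure lebesgue (superlevel w (2 ^ k * \<delta>))
    \<le> ennreal (\<theta> ^ k) * emeasure lebesgue (superlevel w \<delta>)"
proof (induction k)
  case (Suc k)
  let ?n = "CARD('n)" and ?\<mu> = "\<lambda>t. emeasure lebesgue (superlevel w t)"
  define t where "t = 2 ^ k * \<delta>"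
  have t_bounds: "0 < t" "\<delta> \<le> t"
    using \<delta>_pos by (auto simp: t_def)
  have "ennreal t * ?\<mu> (t + t) \<le> ennreal (2 ^ (?n + 2)) * oscillation_modulus w (L * sqrt ?n) * ?\<mu> t"
    using t_bounds emeasure_superlevel_antimono[OF w_meas t_bounds(2)] small
    by (intro good_lambda w_meas L_pos) auto
  also have "\<dots> \<le> ennreal (2 ^ (?n + 2)) * ennreal (\<delta> * \<theta> / 2 ^ (?n + 2)) * ?\<mu> t"
    using osc by (intro mult_right_mono mult_left_mono) auto
  also have "ennreal (2 ^ (?n + 2)) * ennreal (\<delta> * \<theta> / 2 ^ (?n + 2)) = ennreal (\<delta> * \<theta>)"
    by (simp add: ennreal_mult'[symmetric])
  also have "ennreal (\<delta> * \<theta>) * ?\<mu> t \<le> ennreal (t * \<theta>) * ?\<mu> t"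
    using t_bounds \<theta>_nonneg by (intro mult_right_mono ennreal_leI) auto
  also have "\<dots> = ennreal t * (ennreal \<theta> * ?\<mu> t)"
    using t_bounds \<theta>_nonneg by (simp add: ennreal_mult mult.assoc)
  finally have "?\<mu> (t + t) \<le> ennreal \<theta> * ?\<mu> t"
    using t_bounds by (simp add: ennreal_mult_le_mult_iff)
  also have "\<dots> \<le> ennreal \<theta> * (ennreal (\<theta> ^ k) * ?\<mu> \<delta>)"
    using Suc by (intro mult_left_mono) (auto simp: t_def)
  also have "\<dots> = ennreal (\<theta> ^ Suc k) * ?\<mu> \<delta>"
    using \<theta>_nonneg by (simp add: ennreal_mult mult.assoc)
  also have "t + t = 2 ^ Suc k * \<delta>"
    by (simp add: t_def)
  finally show ?case .
qed simp

lemma real_between_powers_of_2: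
  fixes r :: real
  assumes "1 \<le> r"
  obtains k where "2 ^ k \<le> r" "r < 2 ^ Suc k"
proof
  have "0 \<le> \<lfloor>log 2 r\<rfloor>"
    using assms by simp
  then show "2 ^ nat \<lfloor>log 2 r\<rfloor> \<le> r" "r < 2 ^ Suc (nat \<lfloor>log 2 r\<rfloor>)"
    using assms floor_log_eq_powr_iff[of r 2 "\<lfloor>log 2 r\<rfloor>"]
    by (auto simp flip: powr_realpow simp: powr_add)
qed

lemma superlevel_power_decay:
  fixes w :: "real^'n \<Rightarrow> real"
  assumes w_meas: "w \<in> borel_measurable lebesgue" and L_pos: "0 < L"
    and \<delta>_pos: "0 < \<delta>" and p_nonneg: "0 \<le> p"
    and osc: "oscillation_modulus w (L * sqrt CARD('n)) \<le> ennreal (\<delta> * 2 powr -p / 2 ^ (CARD('n) + 2))"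
    and small: "emeasure lebesgue (superlevel w \<delta>) \<le> ennreal (L ^ CARD('n) / 2 ^ Suc CARD('n))"
    and t_ge: "\<delta> \<le> t"
  shows "emeasure lebesgue (superlevel w t)
    \<le> ennreal ((2 * \<delta> / t) powr p) * emeasure lebesgue (superlevel w \<delta>)"
proof -
  obtain k where k_bounds: "2 ^ k \<le> t / \<delta>" "t / \<delta> < 2 ^ Suc k"
    using real_between_powers_of_2[of "t / \<delta>"] t_ge \<delta>_pos by auto
  have "emeasure lebesgue (superlevel w t) \<le> emeasure lebesgue (superlevel w (2 ^ k * \<delta>))"
    using k_bounds(1) \<delta>_pos by (intro emeasure_superlevel_antimono w_meas) (simp add: field_simps)
  also have "\<dots> \<le> ennreal ((2 powr -p) ^ k) * emeasure lebesgue (superlevel w \<delta>)"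
    by (rule superlevel_dyadic_decay[OF w_meas L_pos \<delta>_pos _ osc small]) simp
  also have "(2 powr -p) ^ k = (1 / 2 ^ k) powr p"
    by (simp add: powr_minus_divide powr_divide power_one_over powr_power powr_powr mult.commute
        flip: powr_realpow)
  also have "ennreal \<dots> \<le> ennreal ((2 * \<delta> / t) powr p)"
    using k_bounds(2) \<delta>_pos t_ge p_nonneg by (intro ennreal_leI powr_mono2) (auto simp: field_simps)
  finally show ?thesis
    by (simp add: mult_right_mono)
qed

section \<open>Interpolation between weak-type bounds\<close>

lemma nn_integral_powr_from_0:
  fixes a c :: real
  assumes "-1 < a" "0 \<le> c"
  shows "(\<integral>\<^sup>+t\<in>{0..c}. ennreal (t powr a) \<partial>lborel) = ennreal (c powr (a + 1) / (a + 1))"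
  using assms by (intro nn_integral_has_integral_lebesgue' has_integral_powr_from_0) auto

lemma nn_integral_powr_to_inf:
  fixes a c :: real
  assumes "a < -1" "0 < c"
  shows "(\<integral>\<^sup>+t\<in>{c..}. ennreal (t powr a) \<partial>lborel) = ennreal (c powr (a + 1) / (- a - 1))"
proof -
  have "- (c powr (a + 1)) / (a + 1) = c powr (a + 1) / (- a - 1)"
    using assms by (simp add: field_simps)
  then show ?thesis
    using nn_integral_has_integral_lebesgue'[OF _ has_integral_powr_to_inf[OF assms]] by simp
qed

lemma ennreal_powr_eq_nn_integral:
  fixes q r :: real
  assumes "0 < q" "0 \<le> r"
  shows "ennreal (r powr q) = (\<integral>\<^sup>+t\<in>{0..<r}. ennreal (q * t powr (q - 1)) \<partial>lborel)"
proof -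
  have "ennreal (r powr q) = ennreal q * (\<integral>\<^sup>+t\<in>{0..r}. ennreal (t powr (q - 1)) \<partial>lborel)"
    using assms by (simp add: nn_integral_powr_from_0 ennreal_mult'[symmetric])
  also have "\<dots> = (\<integral>\<^sup>+t\<in>{0..r}. ennreal (q * t powr (q - 1)) \<partial>lborel)"
    using assms by (simp add: nn_integral_cmult[symmetric] ennreal_mult mult.assoc)
  also have "\<dots> = (\<integral>\<^sup>+t\<in>{0..<r}. ennreal (q * t powr (q - 1)) \<partial>lborel)"
  proof (rule nn_integral_cong_AE)
    show "AE t in lborel. ennreal (q * t powr (q - 1)) * indicator {0..r} t
        = ennreal (q * t powr (q - 1)) * indicator {0..<r} t"
      using AE_lborel_singleton[of r] by eventually_elim (auto simp: indicator_def)
  qed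
  finally show ?thesis .
qed

lemma layer_cake:
  fixes f :: "'a \<Rightarrow> real" and q :: real
  assumes "sigma_finite_measure M" and f_meas [measurable]: "f \<in> borel_measurable M" and q_pos: "0 < q"
  shows "(\<integral>\<^sup>+x. ennreal (\<bar>f x\<bar> powr q) \<partial>M)
    = (\<integral>\<^sup>+t\<in>{0..}. ennreal (q * t powr (q - 1)) * emeasure M {x \<in> space M. t < \<bar>f x\<bar>} \<partial>lborel)"
proof -
  interpret sigma_finite_measure M by fact
  interpret pair_sigma_finite M lborel ..
  define g where "g = (\<lambda>x t. ennreal (q * t powr (q - 1)) * indicator {0..<\<bar>f x\<bar>} t)"
  have [measurable]: "(\<lambda>(x, t). g x t) \<in> borel_measurable (M \<Otimes>\<^sub>M lborel)"
    unfolding g_def indicator_def atLeastLessThan_iff by measurable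
  have section_integral: "(\<integral>\<^sup>+x. g x t \<partial>M)
      = ennreal (q * t powr (q - 1)) * emeasure M {x \<in> space M. t < \<bar>f x\<bar>} * indicator {0..} t" for t
  proof -
    have "(\<integral>\<^sup>+x. g x t \<partial>M)
        = (\<integral>\<^sup>+x. ennreal (q * t powr (q - 1)) * indicator {0..} t * indicator {x \<in> space M. t < \<bar>f x\<bar>} x \<partial>M)"
      by (intro nn_integral_cong) (auto simp: g_def indicator_def)
    then show ?thesis
      by (simp add: nn_integral_cmult_indicator) (simp only: mult_ac)
  qed
  have "(\<integral>\<^sup>+x. ennreal (\<bar>f x\<bar> powr q) \<partial>M) = (\<integral>\<^sup>+x. \<integral>\<^sup>+t. g x t \<partial>lborel \<partial>M)"
    unfolding g_def using q_pos by (simp add: ennreal_powr_eq_nn_integral)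
  also have "\<dots> = (\<integral>\<^sup>+t. \<integral>\<^sup>+x. g x t \<partial>M \<partial>lborel)"
    by (intro Fubini'[symmetric]) measurable
  finally show ?thesis
    unfolding section_integral .
qed

lemma powr_weight_times_le:
  fixes c m :: ennreal and q s t :: real
  assumes "0 \<le> q" and weak: "m \<le> c * ennreal (t powr -s)"
  shows "ennreal (q * t powr (q - 1)) * m \<le> ennreal q * (c * ennreal (t powr (q - 1 - s)))"
proof -
  have "ennreal (q * t powr (q - 1)) * m \<le> ennreal (q * t powr (q - 1)) * (c * ennreal (t powr -s))"
    using weak by (rule mult_left_mono) simp
  also have "\<dots> = ennreal q * (c * ennreal (t powr (q - 1) * t powr -s))"
    using assms(1) by (simp add: ennreal_mult mult_ac)
  also have "t powr (q - 1) * t powr -s = t powr (q - 1 - s)"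
    by (simp flip: powr_add)
  finally show ?thesis .
qed

lemma nn_integral_powr_le_weak_interpolation:
  fixes f :: "'a \<Rightarrow> real" and p q r :: real and A B :: ennreal
  assumes sigma_finite: "sigma_finite_measure M" and f_meas: "f \<in> borel_measurable M"
    and exponents: "0 < q" "r < q" "q < p" and \<delta>_pos: "0 < \<delta>"
    and below: "\<And>t. 0 < t \<Longrightarrow> t < \<delta> \<Longrightarrow> emeasure M {x \<in> space M. t < \<bar>f x\<bar>} \<le> A * ennreal (t powr -r)"
    and above: "\<And>t. \<delta> \<le> t \<Longrightarrow> emeasure M {x \<in> space M. t < \<bar>f x\<bar>} \<le> B * ennreal (t powr -p)"
  shows "(\<integral>\<^sup>+x. ennreal (\<bar>f x\<bar> powr q) \<partial>M)
    \<le> ennreal q * (A * ennreal (\<delta> powr (q - r) / (q - r)) + B * ennreal (\<delta> powr (q - p) / (p - q)))"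
proof -
  let ?\<mu> = "\<lambda>t. emeasure M {x \<in> space M. t < \<bar>f x\<bar>}"
  let ?low = "\<lambda>t. ennreal (t powr (q - 1 - r)) * indicator {0..\<delta>} t"
    and ?high = "\<lambda>t. ennreal (t powr (q - 1 - p)) * indicator {\<delta>..} t"
  have layer_le: "ennreal (q * t powr (q - 1)) * ?\<mu> t * indicator {0..} t
      \<le> ennreal q * (A * ?low t + B * ?high t)" for t
  proof -
    consider (nonpos) "t \<le> 0" | (low) "0 < t" "t < \<delta>" | (high) "\<delta> \<le> t" by linarith
    then show ?thesis
    proof cases
      case nonpos
      then show ?thesis
        by (cases "t = 0") (auto simp: indicator_def)
    next
      case low
      then show ?thesis
        using powr_weight_times_le[OF _ below[OF low], of q] exponents(1) by simp
    next
      case high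
      then show ?thesis
        using powr_weight_times_le[OF _ above[OF high], of q] exponents(1) \<delta>_pos
        by (simp add: distrib_left add_increasing)
    qed
  qed
  have "(\<integral>\<^sup>+x. ennreal (\<bar>f x\<bar> powr q) \<partial>M) \<le> (\<integral>\<^sup>+t. ennreal q * (A * ?low t + B * ?high t) \<partial>lborel)"
    unfolding layer_cake[OF sigma_finite f_meas exponents(1)] by (intro nn_integral_mono layer_le)
  also have "\<dots> = ennreal q * (A * (\<integral>\<^sup>+t. ?low t \<partial>lborel) + B * (\<integral>\<^sup>+t. ?high t \<partial>lborel))"
    by (simp add: nn_integral_add nn_integral_cmult)
  also have "(\<integral>\<^sup>+t. ?low t \<partial>lborel) = ennreal (\<delta> powr (q - r) / (q - r))"
    using exponents \<delta>_pos by (simp add: nn_integral_powr_from_0)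
  also have "(\<integral>\<^sup>+t. ?high t \<partial>lborel) = ennreal (\<delta> powr (q - p) / (p - q))"
    using exponents \<delta>_pos by (simp add: nn_integral_powr_to_inf)
  finally show ?thesis .
qed

section \<open>Interpolation for functions with small oscillation\<close>

lemma emeasure_superlevel_le_weak_L1_quasinorm:
  assumes "0 < t"
  shows "emeasure lebesgue (superlevel f t) \<le> weak_L1_quasinorm f * ennreal (1 / t)"
proof -
  have "emeasure lebesgue (superlevel f t)
      = ennreal t * emeasure lebesgue (superlevel f t) * ennreal (1 / t)"
    using assms
    by (simp add: mult.commute mult.left_commute ennreal_mult'[symmetric] mult.assoc[symmetric])
  also have "\<dots> \<le> weak_L1_quasinorm f * ennreal (1 / t)"
    unfolding weak_L1_quasinorm_def superlevel_def
    using assms by (intro mult_right_mono SUP_upper) auto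
  finally show ?thesis .
qed

lemma superlevel_power_decay_weak_L1:
  fixes w :: "real^'n \<Rightarrow> real"
  assumes w_meas: "w \<in> borel_measurable lebesgue" and L_pos: "0 < L"
    and \<delta>_pos: "0 < \<delta>" and p_nonneg: "0 \<le> p"
    and osc: "oscillation_modulus w (L * sqrt CARD('n)) \<le> ennreal (\<delta> * 2 powr -p / 2 ^ (CARD('n) + 2))"
    and small: "weak_L1_quasinorm w \<le> ennreal (\<delta> * (L ^ CARD('n) / 2 ^ Suc CARD('n)))"
    and t_ge: "\<delta> \<le> t"
  shows "emeasure lebesgue (superlevel w t)
    \<le> weak_L1_quasinorm w * ennreal ((2 * \<delta>) powr p / \<delta>) * ennreal (t powr -p)"
proof -
  let ?\<mu> = "\<lambda>t. emeasure lebesgue (superlevel w t)" and ?K = "weak_L1_quasinorm w"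
  have weak: "?\<mu> \<delta> \<le> ?K * ennreal (1 / \<delta>)"
    using \<delta>_pos by (rule emeasure_superlevel_le_weak_L1_quasinorm)
  also have "\<dots> \<le> ennreal (\<delta> * (L ^ CARD('n) / 2 ^ Suc CARD('n))) * ennreal (1 / \<delta>)"
    using small by (rule mult_right_mono) simp
  also have "\<dots> = ennreal (L ^ CARD('n) / 2 ^ Suc CARD('n))"
    using \<delta>_pos L_pos by (simp add: ennreal_mult'[symmetric])
  finally have "?\<mu> t \<le> ennreal ((2 * \<delta> / t) powr p) * ?\<mu> \<delta>"
    by (intro superlevel_power_decay[OF w_meas L_pos \<delta>_pos p_nonneg osc _ t_ge])
  also have "\<dots> \<le> ennreal ((2 * \<delta> / t) powr p) * (?K * ennreal (1 / \<delta>))"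
    using weak by (rule mult_left_mono) simp
  also have "\<dots> = ?K * ennreal ((2 * \<delta> / t) powr p * (1 / \<delta>))"
    by (subst ennreal_mult') (auto simp: mult_ac)
  also have "(2 * \<delta> / t) powr p * (1 / \<delta>) = (2 * \<delta>) powr p / \<delta> * t powr -p"
    using \<delta>_pos t_ge by (simp add: powr_divide powr_minus_divide)
  also have "ennreal \<dots> = ennreal ((2 * \<delta>) powr p / \<delta>) * ennreal (t powr -p)"
    by (rule ennreal_mult'') simp
  finally show ?thesis
    by (simp only: mult.assoc)
qed

definition interpolation_constant :: "real \<Rightarrow> real" where
  "interpolation_constant q = q * (1 / (q - 1) + 2 powr (q + 1))"

lemma nn_integral_powr_le_weak_L1_quasinorm:
  fixes w :: "real^'n \<Rightarrow> real"
  assumes w_meas: "w \<in> borel_measurable lebesgue"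
    and q_gt_1: "1 < q" and L_pos: "0 < L" and \<delta>_pos: "0 < \<delta>"
    and osc: "oscillation_modulus w (L * sqrt CARD('n))
      \<le> ennreal (\<delta> * 2 powr -(q + 1) / 2 ^ (CARD('n) + 2))"
    and small: "weak_L1_quasinorm w \<le> ennreal (\<delta> * (L ^ CARD('n) / 2 ^ Suc CARD('n)))"
  shows "(\<integral>\<^sup>+x. ennreal (\<bar>w x\<bar> powr q) \<partial>lebesgue)
    \<le> ennreal (interpolation_constant q * \<delta> powr (q - 1)) * weak_L1_quasinorm w"
proof -
  let ?\<mu> = "\<lambda>t. emeasure lebesgue (superlevel w t)" and ?K = "weak_L1_quasinorm w"
  let ?c = "(2 * \<delta>) powr (q + 1) / \<delta>"
  have below: "?\<mu> t \<le> ?K * ennreal (t powr -1)" if "0 < t" for t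
    using emeasure_superlevel_le_weak_L1_quasinorm[OF that, of w] that
    by (simp add: powr_minus_divide)
  have above: "?\<mu> t \<le> ?K * ennreal ?c * ennreal (t powr -(q + 1))" if "\<delta> \<le> t" for t
    by (rule superlevel_power_decay_weak_L1[OF w_meas L_pos \<delta>_pos _ osc small that]) (use q_gt_1 in simp)
  have "(\<integral>\<^sup>+x. ennreal (\<bar>w x\<bar> powr q) \<partial>lebesgue)
    \<le> ennreal q * (?K * ennreal (\<delta> powr (q - 1) / (q - 1))
      + ?K * ennreal ?c * ennreal (\<delta> powr (q - (q + 1)) / (q + 1 - q)))"
    using below above q_gt_1
    by (intro nn_integral_powr_le_weak_interpolation[OF lebesgue.sigma_finite_measure_axioms w_meas] \<delta>_pos)
       (auto simp: superlevel_def)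
  also have "\<dots> = ennreal (q * (\<delta> powr (q - 1) / (q - 1) + ?c * \<delta> powr -1)) * ?K"
  proof -
    have "ennreal a * (?K * ennreal b + ?K * ennreal c * ennreal d) = ennreal (a * (b + c * d)) * ?K"
      if "0 \<le> a" "0 \<le> b" "0 \<le> c" "0 \<le> d" for a b c d
      using that by (simp add: ennreal_mult distrib_left distrib_right mult_ac)
    then show ?thesis
      using q_gt_1 \<delta>_pos by simp
  qed
  also have "q * (\<delta> powr (q - 1) / (q - 1) + ?c * \<delta> powr -1) = interpolation_constant q * \<delta> powr (q - 1)"
  proof -
    have "?c * \<delta> powr -1 = 2 powr (q + 1) * (\<delta> powr (q + 1) * \<delta> powr -1 * \<delta> powr -1)"
      using \<delta>_pos by (simp add: powr_mult powr_minus_divide)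
    also have "\<dots> = 2 powr (q + 1) * \<delta> powr (q - 1)"
      by (simp only: powr_add[symmetric]) simp
    finally show ?thesis
      by (simp add: interpolation_constant_def algebra_simps)
  qed
  finally show ?thesis .
qed

section \<open>Increments of functions in \<open>BV_w\<close> and \<open>VMO\<close>\<close>

lemma VMO_small_oscillation_modulus:
  assumes "u \<in> VMO" "0 < \<eta>"
  obtains R where "0 < R" "oscillation_modulus u R \<le> ennreal \<eta>"
proof -
  have "(oscillation_modulus u \<longlongrightarrow> 0) (at_right 0)"
    using assms(1) by (simp add: VMO_def oscillation_modulus_def[abs_def])
  then have "eventually (\<lambda>R. oscillation_modulus u R < ennreal \<eta> \<and> 0 < R) (at_right 0)"
    using assms(2) by (intro eventually_conj order_tendstoD(2) eventually_at_right_less) auto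
  then obtain R where "oscillation_modulus u R < ennreal \<eta>" "0 < R"
    using eventually_happens'[OF trivial_limit_at_right_real] by blast
  with that show thesis
    by (simp add: less_imp_le)
qed

lemma BV_w_increment_bound:
  fixes u :: "real^'n \<Rightarrow> real"
  assumes "u \<in> BV_w"
  obtains M where "0 \<le> M"
    "\<And>h. h \<noteq> 0 \<Longrightarrow> weak_L1_quasinorm (\<lambda>x. u (x + h) - u x) \<le> ennreal (M * norm h)"
proof -
  define S where "S = (SUP h\<in>UNIV - {0}. weak_L1_quasinorm (\<lambda>x. u (x + h) - u x) / ennreal (norm h))"
  have "S < \<infinity>"
    using assms by (simp add: BV_w_def S_def)
  then obtain M where S_eq: "0 \<le> M" "S = ennreal M"
    by (cases S) auto
  have "weak_L1_quasinorm (\<lambda>x. u (x + h) - u x) \<le> ennreal (M * norm h)" if "h \<noteq> 0" for h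
  proof -
    let ?K = "weak_L1_quasinorm (\<lambda>x. u (x + h) - u x)"
    have "?K = ?K / ennreal (norm h) * ennreal (norm h)"
      using that by (simp add: ennreal_divide_times)
    also have "\<dots> \<le> S * ennreal (norm h)"
      unfolding S_def using that by (intro mult_right_mono SUP_upper) auto
    finally show ?thesis
      using S_eq by (simp add: ennreal_mult')
  qed
  with S_eq(1) that show thesis
    by blast
qed

lemma nn_integral_difference_quotient_le:
  fixes u :: "real^'n \<Rightarrow> real"
  assumes u_meas [measurable]: "u \<in> borel_measurable lebesgue"
    and q_gt_1: "1 < q" and L_pos: "0 < L" and \<delta>_pos: "0 < \<delta>" and M_nonneg: "0 \<le> M"
    and h_nonzero: "h \<noteq> 0"
    and osc: "2 * oscillation_modulus u (L * sqrt CARD('n))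
      \<le> ennreal (\<delta> * 2 powr -(q + 1) / 2 ^ (CARD('n) + 2))"
    and weak: "weak_L1_quasinorm (\<lambda>x. u (x + h) - u x) \<le> ennreal (M * norm h)"
    and h_small: "M * norm h \<le> \<delta> * (L ^ CARD('n) / 2 ^ Suc CARD('n))"
  shows "(\<integral>\<^sup>+x. ennreal (\<bar>u (x + h) - u x\<bar> powr q / norm h) \<partial>lebesgue)
    \<le> ennreal (interpolation_constant q * M * \<delta> powr (q - 1))"
proof -
  let ?w = "\<lambda>x. u (x + h) - u x"
  let ?c = "interpolation_constant q * \<delta> powr (q - 1)"
  have w_meas [measurable]: "?w \<in> borel_measurable lebesgue"
    by measurable
  have "(\<integral>\<^sup>+x. ennreal (\<bar>?w x\<bar> powr q) \<partial>lebesgue) \<le> ennreal ?c * weak_L1_quasinorm ?w"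
    using oscillation_modulus_increment_le[OF u_meas] osc weak h_small
    by (intro nn_integral_powr_le_weak_L1_quasinorm[OF w_meas q_gt_1 L_pos \<delta>_pos])
       (auto intro: order_trans ennreal_leI)
  also have "\<dots> \<le> ennreal ?c * ennreal (M * norm h)"
    using weak by (rule mult_left_mono) simp
  also have "\<dots> = ennreal (?c * M) * ennreal (norm h)"
    using M_nonneg by (simp add: ennreal_mult'' mult.assoc)
  finally have "(\<integral>\<^sup>+x. ennreal (\<bar>?w x\<bar> powr q) \<partial>lebesgue) / ennreal (norm h)
      \<le> ennreal (?c * M) * ennreal (norm h) / ennreal (norm h)"
    by (rule divide_right_mono_ennreal)
  also have "\<dots> = ennreal (interpolation_constant q * M * \<delta> powr (q - 1))"
    using h_nonzero by (subst mult_divide_eq_ennreal) (auto simp: mult_ac)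
  also have "(\<integral>\<^sup>+x. ennreal (\<bar>?w x\<bar> powr q) \<partial>lebesgue) / ennreal (norm h)
      = (\<integral>\<^sup>+x. ennreal (\<bar>?w x\<bar> powr q / norm h) \<partial>lebesgue)"
    using h_nonzero by (simp add: nn_integral_divide[symmetric] divide_ennreal)
  finally show ?thesis .
qed

lemma VMO_eventually_difference_quotient_le:
  fixes u :: "real^'n \<Rightarrow> real"
  assumes q_gt_1: "1 < q" and u_VMO: "u \<in> VMO" and M_nonneg: "0 \<le> M" and \<delta>_pos: "0 < \<delta>"
    and weak: "\<And>h. h \<noteq> 0 \<Longrightarrow> weak_L1_quasinorm (\<lambda>x. u (x + h) - u x) \<le> ennreal (M * norm h)"
  shows "\<forall>\<^sub>F h in at 0. (\<integral>\<^sup>+x. ennreal (\<bar>u (x + h) - u x\<bar> powr q / norm h) \<partial>lebesgue)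
    \<le> ennreal (interpolation_constant q * M * \<delta> powr (q - 1))"
proof -
  let ?n = "CARD('n)"
  have u_meas: "u \<in> borel_measurable lebesgue"
    using u_VMO by (simp add: VMO_def BMO_def L1_loc_def)
  define \<eta> where "\<eta> = \<delta> * 2 powr -(q + 1) / 2 ^ (?n + 2)"
  have "0 < \<eta> / 2"
    using \<delta>_pos by (simp add: \<eta>_def)
  then obtain R where R_small: "0 < R" "oscillation_modulus u R \<le> ennreal (\<eta> / 2)"
    using VMO_small_oscillation_modulus[OF u_VMO] by blast
  define L where "L = R / sqrt ?n"
  have L_eq: "0 < L" "L * sqrt ?n = R"
    using R_small(1) by (auto simp: L_def)
  have "2 * oscillation_modulus u R \<le> 2 * ennreal (\<eta> / 2)"
    using R_small(2) by (rule mult_left_mono) simp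
  also have "\<dots> = ennreal \<eta>"
    by (simp add: ennreal_mult'[symmetric] flip: ennreal_numeral)
  finally have osc: "2 * oscillation_modulus u (L * sqrt ?n) \<le> ennreal \<eta>"
    unfolding L_eq(2) .
  have "((\<lambda>h :: real^'n. M * norm h) \<longlongrightarrow> M * norm (0 :: real^'n)) (at 0)"
    by (intro tendsto_intros)
  then have "\<forall>\<^sub>F h in at (0 :: real^'n). M * norm h < \<delta> * (L ^ ?n / 2 ^ Suc ?n)"
    using \<delta>_pos L_eq by (intro order_tendstoD(2)) auto
  moreover have "\<forall>\<^sub>F h in at (0 :: real^'n). h \<noteq> 0"
    by (rule eventually_neq_at_within)
  ultimately show ?thesis
  proof eventually_elim
    case (elim h)
    show ?case
      using osc weak[OF elim(2)] elim unfolding \<eta>_def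
      by (intro nn_integral_difference_quotient_le[OF u_meas q_gt_1 L_eq(1) \<delta>_pos M_nonneg]) auto
  qed
qed

theorem theorem1p18:
  fixes u :: "real^'n \<Rightarrow> real" and q :: real
  assumes "1 < q"
    and "u \<in> BV_w \<inter> VMO"
  shows "((\<lambda>h. \<integral>\<^sup>+x. ennreal (\<bar>u (x + h) - u x\<bar> powr q / norm h) \<partial>lebesgue) \<longlongrightarrow> 0) (at 0)"
proof (rule tendsto_zero_ennreal)
  fix e :: real assume "0 < e"
  obtain M where weak_bound: "0 \<le> M"
    "\<And>h. h \<noteq> 0 \<Longrightarrow> weak_L1_quasinorm (\<lambda>x. u (x + h) - u x) \<le> ennreal (M * norm h)"
    using BV_w_increment_bound assms(2) by blast
  let ?bound = "\<lambda>\<delta>. interpolation_constant q * M * \<delta> powr (q - 1)"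
  have "(?bound \<longlongrightarrow> interpolation_constant q * M * 0 powr (q - 1)) (at_right 0)"
    using assms(1)
    by (intro tendsto_intros tendsto_powr') (auto simp: eventually_at_right_field intro: exI[of _ 1])
  then have "\<forall>\<^sub>F \<delta> in at_right 0. ?bound \<delta> < e \<and> 0 < \<delta>"
    using \<open>0 < e\<close> by (intro eventually_conj order_tendstoD(2) eventually_at_right_less) auto
  then obtain \<delta> where \<delta>_small: "?bound \<delta> < e" "0 < \<delta>"
    using eventually_happens'[OF trivial_limit_at_right_real] by blast
  have "\<forall>\<^sub>F h in at 0. (\<integral>\<^sup>+x. ennreal (\<bar>u (x + h) - u x\<bar> powr q / norm h) \<partial>lebesgue)
      \<le> ennreal (?bound \<delta>)"
    using assms weak_bound \<delta>_small(2) by (intro VMO_eventually_difference_quotient_le) auto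
  then show "\<forall>\<^sub>F h in at 0. (\<integral>\<^sup>+x. ennreal (\<bar>u (x + h) - u x\<bar> powr q / norm h) \<partial>lebesgue) < ennreal e"
    by (rule eventually_mono) (use \<delta>_small(1) \<open>0 < e\<close> in \<open>auto intro: le_less_trans ennreal_lessI\<close>)
qed

end
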